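(* Let $G$ be a finite group. Then: (1) $\mathrm{Aut}(\overrightarrow{\mathcal{P}}(G))\subseteq\mathrm{Aut}(\overrightarrow{\mathcal{RP}}(G))$; (2) $\mathrm{Aut}(\overrightarrow{\mathcal{RP}}(G))\subseteq\mathrm{Aut}(\overrightarrow{\mathcal{P}}(G))$ if and only if for every $x\in G$, $\widehat{x}$ is either of Type I or of Type II with parameter $(2,r)$, where $r\geq 2$.
   Context: The directed power graph $\overrightarrow{\mathcal{P}}(G)$ has vertex set $G$ and an arc from $u$ to $v$ iff $u\neq v$ and $\langle v\rangle\subseteq\langle u\rangle$. The directed reduced power graph $\overrightarrow{\mathcal{RP}}(G)$ has vertex set $G$ and an arc from $u$ to $v$ iff $\langle v\rangle\subset\langle u\rangle$ (proper inclusion); $\mathcal{RP}(G)$ is its underlying undirected graph. Both automorphism groups are viewed as groups of permutations of the set $G$. For $x\in G$: $[x]=\{y\in G:\langle y\rangle=\langle x\rangle\}$ and $\widehat{x}=\{y\in G: N_{\mathcal{RP}(G)}(y)=N_{\mathcal{RP}(G)}(x)\}$, where $N_{\mathcal{RP}(G)}(x)$ is the set of neighbours of $x$. Each $\widehat{x}$ is a disjoint union of distinct classes $[x_1],\ldots,[x_r]$. $\widehat{x}$ is of Type I if $r=1$, i.e. $\widehat{x}=[x]$. $\widehat{x}$ is of Type II if $r\geq2$ and $\langle x_1\rangle,\ldots,\langle x_r\rangle$ are distinct maximal cyclic subgroups of $G$ of the same order; in that case its parameter is $(o(x),r)$, where $o(x)$ is the order of $x$. *)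

theory Defs
  imports
    "HOL-Algebra.Elementary_Groups"
    "HOL-Algebra.Multiplicative_Group"
    "HOL-Combinatorics.Permutations"
    "Graph_Theory.Digraph_Component"
begin

definition directed_power_graph :: "('a, 'b) monoid_scheme \<Rightarrow> 'a pair_pre_digraph"
  where "directed_power_graph G =
    \<lparr> pverts = carrier G,
      parcs = {(u, v). u \<in> carrier G \<and> v \<in> carrier G \<and> u \<noteq> v \<and>
                       generate G {v} \<subseteq> generate G {u}} \<rparr>"

definition directed_reduced_power_graph :: "('a, 'b) monoid_scheme \<Rightarrow> 'a pair_pre_digraph"
  where "directed_reduced_power_graph G =
    \<lparr> pverts = carrier G,
      parcs = {(u, v). u \<in> carrier G \<and> v \<in> carrier G \<and>
                       generate G {v} \<subset> generate G {u}} \<rparr>"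

text \<open>An undirected graph is represented by a symmetric arc relation.\<close>

definition reduced_power_graph :: "('a, 'b) monoid_scheme \<Rightarrow> 'a pair_pre_digraph"
  where "reduced_power_graph G = mk_symmetric (directed_reduced_power_graph G)"

definition neighbours :: "'a pair_pre_digraph \<Rightarrow> 'a \<Rightarrow> 'a set"
  where "neighbours D x = {y \<in> pverts D. (x, y) \<in> parcs D}"

text \<open>The underlying set of the automorphism group. Since \<open>permutes\<close> makes a permutation the
  identity outside the vertex set, automorphisms of digraphs on the same vertex set can be
  compared as functions.\<close>

definition digraph_Aut :: "'a pair_pre_digraph \<Rightarrow> ('a \<Rightarrow> 'a) set"
  where "digraph_Aut D =
    {f. f permutes pverts D \<and>
        (\<forall>u \<in> pverts D. \<forall>v \<in> pverts D. (f u, f v) \<in> parcs D \<longleftrightarrow> (u, v) \<in> parcs D)}"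

definition cyclic_class :: "('a, 'b) monoid_scheme \<Rightarrow> 'a \<Rightarrow> 'a set"
  where "cyclic_class G x = {y \<in> carrier G. generate G {y} = generate G {x}}"

definition hat_class :: "('a, 'b) monoid_scheme \<Rightarrow> 'a \<Rightarrow> 'a set"
  where "hat_class G x =
    {y \<in> carrier G. neighbours (reduced_power_graph G) y = neighbours (reduced_power_graph G) x}"

text \<open>The number \<open>r\<close> of distinct classes \<open>[x\<^sub>1], \<dots>, [x\<^sub>r]\<close> whose disjoint union is the hat class
  of \<open>x\<close>.\<close>

definition num_cyclic_classes :: "('a, 'b) monoid_scheme \<Rightarrow> 'a \<Rightarrow> nat"
  where "num_cyclic_classes G x = card (cyclic_class G ` hat_class G x)"

definition cyclic_subgroup :: "'a set \<Rightarrow> ('a, 'b) monoid_scheme \<Rightarrow> bool"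
  where "cyclic_subgroup H G \<longleftrightarrow> subgroup H G \<and> cyclic_group (G \<lparr> carrier := H \<rparr>)"

definition maximal_cyclic_subgroup :: "'a set \<Rightarrow> ('a, 'b) monoid_scheme \<Rightarrow> bool"
  where "maximal_cyclic_subgroup H G \<longleftrightarrow>
    cyclic_subgroup H G \<and> (\<forall>K. cyclic_subgroup K G \<and> H \<subseteq> K \<longrightarrow> K = H)"

definition type_I :: "('a, 'b) monoid_scheme \<Rightarrow> 'a \<Rightarrow> bool"
  where "type_I G x \<longleftrightarrow> hat_class G x = cyclic_class G x"

text \<open>\<open>type_II G x m r\<close>: the hat class of \<open>x\<close> is of Type II with parameter \<open>(m, r)\<close>. The elements of
  \<open>[x\<^sub>i]\<close> all generate \<open>\<langle>x\<^sub>i\<rangle>\<close>, so a condition on the subgroups \<open>\<langle>x\<^sub>1\<rangle>, \<dots>, \<langle>x\<^sub>r\<rangle>\<close> is a condition on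
  \<open>\<langle>y\<rangle>\<close> for every \<open>y\<close> in the hat class; these \<open>r\<close> subgroups are distinct because the classes
  \<open>[x\<^sub>i]\<close> are.\<close>

definition type_II :: "('a, 'b) monoid_scheme \<Rightarrow> 'a \<Rightarrow> nat \<Rightarrow> nat \<Rightarrow> bool"
  where "type_II G x m r \<longleftrightarrow>
    r = num_cyclic_classes G x \<and> r \<ge> 2 \<and>
    (\<forall>y \<in> hat_class G x. maximal_cyclic_subgroup (generate G {y}) G) \<and>
    (\<forall>y \<in> hat_class G x. \<forall>z \<in> hat_class G x. card (generate G {y}) = card (generate G {z})) \<and>
    m = group.ord G x"

end

(* Both digraphs only see the preorder <v> \<subseteq> <u>, and the reduced graph is its strict part,
   which gives (1). Two elements with the same neighbours in the reduced power graph are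
   incomparable, and they even have the same in- and out-neighbours; hence transposing two
   elements of a hat class is an automorphism of the directed reduced power graph.

   For (2), suppose every such automorphism preserves the directed power graph, and let a hat class
   contain two different cyclic classes. A cyclic class inside it with two elements could be
   broken by such a transposition, so all its elements are involutions, and they generate maximal
   cyclic subgroups because a cyclic group has at most one involution. Conversely, the
   neighbourhood of an element of a Type II hat class with parameter (2,r) is just the identity, so
   two generators of one cyclic subgroup mapped into that hat class already belong to it, and
   involutions generating the same subgroup are equal. *)
theory Submission
  imports Defs
begin

section \<open>Arcs and automorphisms in terms of inclusion of generated subgroups\<close>

lemma parcs_directed_power_graph:
  "(u, v) \<in> parcs (directed_power_graph G) \<longleftrightarrow>
    u \<in> carrier G \<and> v \<in> carrier G \<and> u \<noteq> v \<and> generate G {v} \<subseteq> generate G {u}"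
  by (simp add: directed_power_graph_def)

lemma parcs_directed_reduced_power_graph:
  "(u, v) \<in> parcs (directed_reduced_power_graph G) \<longleftrightarrow>
    u \<in> carrier G \<and> v \<in> carrier G \<and> generate G {v} \<subset> generate G {u}"
  by (simp add: directed_reduced_power_graph_def)

lemma pverts_power_graphs [simp]:
  "pverts (directed_power_graph G) = carrier G"
  "pverts (directed_reduced_power_graph G) = carrier G"
  by (simp_all add: directed_power_graph_def directed_reduced_power_graph_def)

lemma neighbours_reduced_power_graph:
  assumes "x \<in> carrier G"
  shows "neighbours (reduced_power_graph G) x =
    {y \<in> carrier G. generate G {x} \<subset> generate G {y} \<or> generate G {y} \<subset> generate G {x}}"
proof -
  have "(x, y) \<in> parcs (reduced_power_graph G) \<longleftrightarrow>
      (x, y) \<in> parcs (directed_reduced_power_graph G) \<or>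
      (y, x) \<in> parcs (directed_reduced_power_graph G)" for y
    by (auto simp: reduced_power_graph_def parcs_mk_symmetric intro: rev_bexI)
  then show ?thesis
    using assms
    by (auto simp: neighbours_def parcs_directed_reduced_power_graph reduced_power_graph_def)
qed

lemma digraph_Aut_directed_power_graph:
  "f \<in> digraph_Aut (directed_power_graph G) \<longleftrightarrow> f permutes carrier G \<and>
    (\<forall>u\<in>carrier G. \<forall>v\<in>carrier G.
      generate G {f v} \<subseteq> generate G {f u} \<longleftrightarrow> generate G {v} \<subseteq> generate G {u})"
proof (cases "f permutes carrier G")
  case True
  then have "f u \<in> carrier G \<longleftrightarrow> u \<in> carrier G" "f u = f v \<longleftrightarrow> u = v" for u v
    by (simp_all add: permutes_in_image permutes_inj inj_eq)
  then show ?thesis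
    using True by (simp add: digraph_Aut_def parcs_directed_power_graph) (metis order_refl)
qed (simp add: digraph_Aut_def)

lemma digraph_Aut_directed_reduced_power_graph:
  "f \<in> digraph_Aut (directed_reduced_power_graph G) \<longleftrightarrow> f permutes carrier G \<and>
    (\<forall>u\<in>carrier G. \<forall>v\<in>carrier G.
      generate G {f v} \<subset> generate G {f u} \<longleftrightarrow> generate G {v} \<subset> generate G {u})"
  by (cases "f permutes carrier G")
    (simp_all add: digraph_Aut_def parcs_directed_reduced_power_graph permutes_in_image)

text \<open>Lets a one-way preservation result for all automorphisms be turned into an
  equivalence.\<close>

lemma digraph_Aut_inv:
  assumes "f \<in> digraph_Aut D"
  shows "inv_into UNIV f \<in> digraph_Aut D"
proof -
  let ?g = "inv_into UNIV f"
  have f: "f permutes pverts D"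
    using assms by (simp add: digraph_Aut_def)
  have "(?g u, ?g v) \<in> parcs D \<longleftrightarrow> (u, v) \<in> parcs D"
    if "u \<in> pverts D" "v \<in> pverts D" for u v
  proof -
    have "?g u \<in> pverts D" "?g v \<in> pverts D"
      using that f by (simp_all add: permutes_inv permutes_in_image)
    then have "(f (?g u), f (?g v)) \<in> parcs D \<longleftrightarrow> (?g u, ?g v) \<in> parcs D"
      using assms by (simp add: digraph_Aut_def)
    then show ?thesis
      by (simp add: permutes_inverses[OF f])
  qed
  then show ?thesis
    using f by (simp add: digraph_Aut_def permutes_inv)
qed

text \<open>Consequently elements with equal neighbourhoods have images with equal neighbourhoods,
  so automorphisms respect hat classes.\<close>

lemma neighbours_reduced_power_graph_image:
  assumes f: "f \<in> digraph_Aut (directed_reduced_power_graph G)" and x: "x \<in> carrier G"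
  shows "neighbours (reduced_power_graph G) (f x) = f ` neighbours (reduced_power_graph G) x"
proof -
  have p: "f permutes carrier G"
    and iff: "\<And>u v. \<lbrakk>u \<in> carrier G; v \<in> carrier G\<rbrakk> \<Longrightarrow>
      generate G {f v} \<subset> generate G {f u} \<longleftrightarrow> generate G {v} \<subset> generate G {u}"
    using f by (simp_all add: digraph_Aut_directed_reduced_power_graph)
  have fx: "f x \<in> carrier G"
    using p x by (simp add: permutes_in_image)
  \<comment> \<open>Every vertex is an image under \<open>f\<close>, so the neighbours of
    \<open>f x\<close> may be parametrised by preimages.\<close>
  have "{z \<in> f ` carrier G. P z} = f ` {y \<in> carrier G. P (f y)}" for P
    by auto
  then have "{z \<in> carrier G. P z} = f ` {y \<in> carrier G. P (f y)}" for P
    unfolding permutes_image[OF p] .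
  then have "neighbours (reduced_power_graph G) (f x) = f ` {y \<in> carrier G.
      generate G {f x} \<subset> generate G {f y} \<or> generate G {f y} \<subset> generate G {f x}}"
    unfolding neighbours_reduced_power_graph[OF fx] .
  also have "\<dots> = f ` neighbours (reduced_power_graph G) x"
    using x by (simp add: neighbours_reduced_power_graph iff cong: conj_cong)
  finally show ?thesis .
qed

section \<open>Order properties of hat classes and transpositions inside them\<close>

lemma hat_class_incomparable:
  assumes "y \<in> hat_class G x" "z \<in> hat_class G x"
  shows "\<not> generate G {y} \<subset> generate G {z}"
proof
  assume less: "generate G {y} \<subset> generate G {z}"
  have "y \<in> carrier G" "z \<in> carrier G"
    "neighbours (reduced_power_graph G) y = neighbours (reduced_power_graph G) z"
    using assms by (auto simp: hat_class_def)
  \<comment> \<open>Being a neighbour of \<open>y\<close>, \<open>z\<close> is also one of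
    \<open>z\<close> itself, but strict inclusion is irreflexive.\<close>
  then have "z \<in> neighbours (reduced_power_graph G) z"
    using less neighbours_reduced_power_graph[of y G] by blast
  then show False
    using \<open>z \<in> carrier G\<close> by (simp add: neighbours_reduced_power_graph)
qed

text \<open>Equal neighbourhoods give equal comparability with \<open>w\<close>. If \<open>w\<close>
  were below one element and above the other, transitivity would make \<open>y\<close> and
  \<open>z\<close> comparable.\<close>

lemma hat_class_below_iff:
  assumes y: "y \<in> hat_class G x" and z: "z \<in> hat_class G x" and w: "w \<in> carrier G"
  shows "generate G {w} \<subset> generate G {y} \<longleftrightarrow> generate G {w} \<subset> generate G {z}"
    and "generate G {y} \<subset> generate G {w} \<longleftrightarrow> generate G {z} \<subset> generate G {w}"
proof -
  have "y \<in> carrier G" "z \<in> carrier G"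
    "neighbours (reduced_power_graph G) y = neighbours (reduced_power_graph G) z"
    using y z by (auto simp: hat_class_def)
  then have comp: "generate G {y} \<subset> generate G {w} \<or> generate G {w} \<subset> generate G {y} \<longleftrightarrow>
      generate G {z} \<subset> generate G {w} \<or> generate G {w} \<subset> generate G {z}"
    using w by (simp add: neighbours_reduced_power_graph set_eq_iff) metis
  show "generate G {w} \<subset> generate G {y} \<longleftrightarrow> generate G {w} \<subset> generate G {z}"
    and "generate G {y} \<subset> generate G {w} \<longleftrightarrow> generate G {z} \<subset> generate G {w}"
    using comp hat_class_incomparable[OF y z] hat_class_incomparable[OF z y] by (meson psubset_trans)+
qed

lemma transpose_hat_class_in_digraph_Aut:
  assumes y: "y \<in> hat_class G x" and z: "z \<in> hat_class G x"
  shows "Transposition.transpose y z \<in> digraph_Aut (directed_reduced_power_graph G)"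
proof -
  let ?f = "Transposition.transpose y z"
  have "y \<in> carrier G" "z \<in> carrier G"
    using y z by (auto simp: hat_class_def)
  then have p: "?f permutes carrier G"
    by (simp add: permutes_swap_id)
  \<comment> \<open>The two arguments are replaced by their images one at a time; this works because
    \<open>w\<close> ranges over the whole carrier, \<open>y\<close> and \<open>z\<close>
    included.\<close>
  have "generate G {?f v} \<subset> generate G {w} \<longleftrightarrow> generate G {v} \<subset> generate G {w}"
    "generate G {w} \<subset> generate G {?f v} \<longleftrightarrow> generate G {w} \<subset> generate G {v}"
    if "w \<in> carrier G" for v w
    using hat_class_below_iff[OF y z that] unfolding Transposition.transpose_def by simp_all
  then show ?thesis
    using p by (simp add: digraph_Aut_directed_reduced_power_graph permutes_in_image)
qed

section \<open>Cyclic subgroups and involutions\<close>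

context group
begin

text \<open>Allows maximality among cyclic subgroups to be tested on the subgroups
  \<open>generate G {z}\<close> alone.\<close>

lemma cyclic_subgroup_iff:
  "cyclic_subgroup H G \<longleftrightarrow> (\<exists>x\<in>carrier G. H = generate G {x})"
proof
  assume "cyclic_subgroup H G"
  then have H: "subgroup H G" "cyclic_group (G\<lparr>carrier := H\<rparr>)"
    by (auto simp: cyclic_subgroup_def)
  interpret H: group "G\<lparr>carrier := H\<rparr>"
    using H(1) by (rule subgroup_imp_group)
  obtain x where x: "x \<in> H" "H = range (\<lambda>n::int. x [^]\<^bsub>G\<lparr>carrier := H\<rparr>\<^esub> n)"
    using H(2) by (auto simp: H.cyclic_group)
  then have "H = generate (G\<lparr>carrier := H\<rparr>) {x}"
    using H.generate_pow[of x] by auto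
  then have "H = generate G {x}"
    using generate_consistent[of "{x}" H] H(1) x(1) by simp
  then show "\<exists>x\<in>carrier G. H = generate G {x}"
    using x(1) subgroup.mem_carrier[OF H(1)] by blast
next
  assume "\<exists>x\<in>carrier G. H = generate G {x}"
  then obtain x where x: "x \<in> carrier G" "H = generate G {x}"
    by blast
  then have "subgroup H G"
    by (simp add: generate_is_subgroup)
  moreover have "cyclic_group (G\<lparr>carrier := H\<rparr>)"
    using cyclic_group_generated[of x] x by (simp add: subgroup_generated_def)
  ultimately show "cyclic_subgroup H G"
    by (simp add: cyclic_subgroup_def)
qed

lemma generate_singleton_subset_iff:
  assumes "x \<in> carrier G" "y \<in> carrier G"
  shows "generate G {y} \<subseteq> generate G {x} \<longleftrightarrow> y \<in> generate G {x}"
  using assms generate_subgroup_incl[of "{y}" "generate G {x}"] generate_is_subgroup[of "{x}"]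
    generate.incl[of y "{y}" G]
  by auto

lemma generate_one_psubset:
  assumes "x \<in> carrier G" "x \<noteq> \<one>"
  shows "generate G {\<one>} \<subset> generate G {x}"
  using assms generate.incl[of x "{x}" G] generate.one[of G "{x}"] by (auto simp: generate_one)

lemma generate_involution:
  assumes "y \<in> carrier G" "y \<otimes> y = \<one>"
  shows "generate G {y} = {\<one>, y}"
proof
  have "inv y = y"
    using assms by (simp add: inv_equality)
  then have "subgroup {\<one>, y} G"
    using assms by (auto intro!: subgroupI)
  then show "generate G {y} \<subseteq> {\<one>, y}"
    by (intro generate_subgroup_incl) auto
  show "{\<one>, y} \<subseteq> generate G {y}"
    using generate.incl[of y "{y}" G] generate.one[of G "{y}"] by auto
qed

lemma generate_eq_if_card_2:
  assumes "card (generate G {y}) = 2"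
  shows "generate G {y} = {\<one>, y}"
proof -
  have "y \<noteq> \<one>"
    using assms by (auto simp: generate_one)
  \<comment> \<open>An infinite set has \<open>card\<close> 0, not 2.\<close>
  moreover have "finite (generate G {y})"
    using assms card.infinite by fastforce
  moreover have "{\<one>, y} \<subseteq> generate G {y}"
    using generate.incl[of y "{y}" G] generate.one[of G "{y}"] by auto
  ultimately show ?thesis
    using assms card_subset_eq[of "generate G {y}" "{\<one>, y}"] by simp
qed

(* The exponents i, j of two involutions are both odd multiples of half the order of z, so
   z^(i+j) = 1. *)
lemma cyclic_involution_unique:
  assumes z: "z \<in> carrier G" and a: "a \<in> generate G {z}" "a \<otimes> a = \<one>" "a \<noteq> \<one>"
    and b: "b \<in> generate G {z}" "b \<otimes> b = \<one>" "b \<noteq> \<one>"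
  shows "a = b"
proof -
  obtain i j :: int where ij: "a = z [^] i" "b = z [^] j"
    using a(1) b(1) by (auto simp: generate_pow[OF z])
  define n where "n = int (ord z)"
  have pow_add: "z [^] k \<otimes> z [^] l = \<one> \<longleftrightarrow> n dvd k + l" for k l :: int
    using z by (metis n_def int_pow_mult int_pow_eq_id)
  have "n dvd i + i" "\<not> n dvd i" "n dvd j + j" "\<not> n dvd j"
    using a(2,3) b(2,3) z unfolding ij pow_add by (simp_all add: n_def int_pow_eq_id)
  then obtain s t where st: "i + i = n * s" "j + j = n * t" and n: "\<not> n dvd i" "\<not> n dvd j"
    by (auto simp: dvd_def)
  \<comment> \<open>An even \<open>s = 2 * k\<close> would give \<open>i = n * k\<close>, against
    \<open>\<not> n dvd i\<close>; likewise for \<open>t\<close>.\<close>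
  have "odd s" "odd t"
    using st n by (auto elim!: evenE)
  then obtain u where "s + t = 2 * u"
    by (metis odd_even_add evenE)
  moreover have "2 * (i + j) = n * (s + t)"
    using st by (simp add: distrib_left)
  ultimately have "2 * (i + j) = 2 * (n * u)"
    by simp
  then have "i + j = n * u"
    by simp
  then have "n dvd i + j"
    by simp
  then have "a \<otimes> b = \<one>"
    by (simp add: ij pow_add)
  then have "a \<otimes> b = b \<otimes> b"
    using b by simp
  then show ?thesis
    using z ij by simp
qed

section \<open>The Type II condition with parameter (2, r) and the two directions of the
  equivalence\<close>

lemma type_II_2_neighbours:
  assumes x: "x \<in> carrier G" and II: "type_II G x 2 r" and y: "y \<in> hat_class G x"
  shows "generate G {y} = {\<one>, y}" and "neighbours (reduced_power_graph G) y = {\<one>}"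
proof -
  have "x \<in> hat_class G x"
    using x by (simp add: hat_class_def)
  then have "card (generate G {y}) = card (generate G {x})"
    using II y unfolding type_II_def by blast
  also have "\<dots> = 2"
    using II x by (simp add: type_II_def generate_pow_card)
  finally have card: "card (generate G {y}) = 2" .
  then show eq: "generate G {y} = {\<one>, y}"
    by (rule generate_eq_if_card_2)
  have yc: "y \<in> carrier G"
    using y by (simp add: hat_class_def)
  have "maximal_cyclic_subgroup (generate G {y}) G"
    using II y by (simp add: type_II_def)
  \<comment> \<open>Maximality excludes neighbours above \<open>y\<close>; order 2 leaves only the
    identity below.\<close>
  then have "\<not> generate G {y} \<subset> generate G {z}" if "z \<in> carrier G" for z
    using that cyclic_subgroup_iff[of "generate G {z}"]
    unfolding maximal_cyclic_subgroup_def by blast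
  moreover have "generate G {z} \<subset> generate G {y} \<longleftrightarrow> z = \<one>" if "z \<in> carrier G" for z
  proof
    assume less: "generate G {z} \<subset> generate G {y}"
    then have "z \<in> {\<one>, y}"
      using generate.incl[of z "{z}" G] eq by auto
    then show "z = \<one>"
      using less by auto
  next
    have "y \<noteq> \<one>"
      using card by (auto simp: generate_one)
    then show "generate G {z} \<subset> generate G {y}" if "z = \<one>"
      using yc that generate_one_psubset by simp
  qed
  ultimately show "neighbours (reduced_power_graph G) y = {\<one>}"
    unfolding neighbours_reduced_power_graph[OF yc] by blast
qed

text \<open>Strict inclusion does not see when two elements generate the same subgroup; this
  supplies the missing information. The images of \<open>u\<close> and \<open>v\<close> share a hat
  class, which settles Type I at once.\<close>

lemma reduced_Aut_preserves_generate_eq: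
  assumes hyp: "\<forall>x\<in>carrier G. type_I G x \<or> (\<exists>r\<ge>2. type_II G x 2 r)"
    and f: "f \<in> digraph_Aut (directed_reduced_power_graph G)"
    and uv: "u \<in> carrier G" "v \<in> carrier G" and eq: "generate G {u} = generate G {v}"
  shows "generate G {f u} = generate G {f v}"
proof -
  have p: "f permutes carrier G"
    using f by (simp add: digraph_Aut_directed_reduced_power_graph)
  have fuv: "f u \<in> carrier G" "f v \<in> carrier G"
    using p uv by (simp_all add: permutes_in_image)
  have Nuv: "neighbours (reduced_power_graph G) u = neighbours (reduced_power_graph G) v"
    using uv eq by (simp add: neighbours_reduced_power_graph)
  then have fv: "f v \<in> hat_class G (f u)"
    using fuv neighbours_reduced_power_graph_image[OF f] uv by (simp add: hat_class_def)
  from hyp fuv(1) consider "type_I G (f u)" | r where "type_II G (f u) 2 r"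
    by blast
  then show ?thesis
  proof cases
    case 1
    then show ?thesis
      using fv by (simp add: type_I_def cyclic_class_def)
  next
    case 2
    have fu: "f u \<in> hat_class G (f u)"
      using fuv by (simp add: hat_class_def)
    show ?thesis
    \<comment> \<open>The identity is treated apart because it is a neighbour of every element but
      itself.\<close>
    proof (cases "u = \<one>")
      case True
      then have "v = \<one>"
        using eq generate.incl[of v "{v}" G] by (auto simp: generate_one)
      then show ?thesis
        using True by simp
    next
      case False
      have N: "neighbours (reduced_power_graph G) (f u) = {\<one>}"
        by (rule type_II_2_neighbours(2)[OF fuv(1) 2 fu])
      moreover have "\<one> \<in> neighbours (reduced_power_graph G) u"
        using generate_one_psubset[OF uv(1) False] uv by (simp add: neighbours_reduced_power_graph)
      \<comment> \<open>The image of this set under the injective \<open>f\<close> is a singleton,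
        so the set has no element besides \<open>\<one>\<close>. Thus \<open>u\<close> has the same
        neighbours as \<open>f u\<close>.\<close>
      ultimately have "neighbours (reduced_power_graph G) u = {\<one>}"
        using neighbours_reduced_power_graph_image[OF f uv(1)] permutes_inj[OF p]
        by (metis image_insert image_empty inj_image_eq_iff singletonD image_eqI)
      then have "u \<in> hat_class G (f u)" "v \<in> hat_class G (f u)"
        using N Nuv uv by (simp_all add: hat_class_def)
      then have "generate G {u} = {\<one>, u}" "generate G {v} = {\<one>, v}"
        using type_II_2_neighbours(1)[OF fuv(1) 2] by blast+
      then have "u = v"
        using eq by (metis doubleton_eq_iff)
      then show ?thesis
        by simp
    qed
  qed
qed

text \<open>A hat class contains the whole cyclic class of \<open>x\<close>, so failure of Type I
  provides a second cyclic class in it. Each later step compares an element with one from a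
  different class.\<close>

lemma type_II_2_if_not_type_I:
  assumes fin: "finite (carrier G)" and x: "x \<in> carrier G"
    and sub: "digraph_Aut (directed_reduced_power_graph G) \<subseteq> digraph_Aut (directed_power_graph G)"
    and not_I: "\<not> type_I G x"
  shows "type_II G x 2 (num_cyclic_classes G x)" and "num_cyclic_classes G x \<ge> 2"
proof -
  let ?H = "hat_class G x"
  have Hc: "?H \<subseteq> carrier G" and xH: "x \<in> ?H"
    using x by (auto simp: hat_class_def)
  have "cyclic_class G x \<subseteq> ?H"
    using x unfolding hat_class_def cyclic_class_def
    by (intro subsetI) (simp add: neighbours_reduced_power_graph)
  then obtain x' where x': "x' \<in> ?H" "generate G {x'} \<noteq> generate G {x}"
    using not_I Hc unfolding type_I_def cyclic_class_def by blast
  have other: "\<exists>w\<in>?H. generate G {w} \<noteq> generate G {y}" for y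
    using x' xH by metis
  have inj: "y' = y"
    if y: "y \<in> ?H" and y': "y' \<in> ?H" and eq: "generate G {y'} = generate G {y}" for y y'
  proof (rule ccontr)
    assume ne: "y' \<noteq> y"
    obtain w where w: "w \<in> ?H" "generate G {w} \<noteq> generate G {y}"
      using other by blast
    let ?f = "Transposition.transpose y' w"
    have "?f \<in> digraph_Aut (directed_power_graph G)"
      using transpose_hat_class_in_digraph_Aut[OF y' w(1)] sub by blast
    moreover have "y \<in> carrier G" "y' \<in> carrier G"
      using y y' Hc by auto
    \<comment> \<open>The transposition moves \<open>y'\<close> to \<open>w\<close> and fixes
      \<open>y\<close>, so this inclusion would make \<open>w\<close> comparable with
      \<open>y\<close>.\<close>
    ultimately have "generate G {?f y'} \<subseteq> generate G {?f y}"
      using eq by (metis digraph_Aut_directed_power_graph order_refl)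
    moreover have "y \<noteq> w"
      using w by blast
    ultimately have "generate G {w} \<subseteq> generate G {y}"
      using ne by (simp add: Transposition.transpose_def)
    then show False
      using w(2) hat_class_incomparable[OF w(1) y] by blast
  qed
  have ne_one: "y \<noteq> \<one>" if y: "y \<in> ?H" for y
  proof
    assume "y = \<one>"
    obtain w where w: "w \<in> ?H" "generate G {w} \<noteq> generate G {y}"
      using other by blast
    then have "generate G {y} \<subset> generate G {w}"
      using Hc \<open>y = \<one>\<close> generate_one_psubset[of w] by auto
    then show False
      using hat_class_incomparable[OF y w(1)] by blast
  qed
  have invol: "y \<otimes> y = \<one>" if y: "y \<in> ?H" for y
  proof -
    have yc: "y \<in> carrier G"
      using y Hc by blast
    \<comment> \<open>\<open>y\<close> and its inverse generate the same subgroup, so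
      \<open>inj\<close> forces them to coincide.\<close>
    have "inv y \<in> generate G {y}" "y \<in> generate G {inv y}"
      using yc generate.inv[of y "{y}" G] generate.inv[of "inv y" "{inv y}" G] by auto
    then have eq: "generate G {inv y} = generate G {y}"
      using yc generate_singleton_subset_iff by (simp add: subset_antisym)
    then have "inv y \<in> ?H"
      using y yc by (simp add: hat_class_def neighbours_reduced_power_graph)
    then have "inv y = y"
      using inj y eq by blast
    then show ?thesis
      using yc r_inv by fastforce
  qed
  have gen: "generate G {y} = {\<one>, y}" if "y \<in> ?H" for y
    using generate_involution invol that Hc by blast
  then have card: "card (generate G {y}) = 2" if "y \<in> ?H" for y
    using that ne_one[OF that] by simp
  have max: "maximal_cyclic_subgroup (generate G {y}) G" if y: "y \<in> ?H" for y
    unfolding maximal_cyclic_subgroup_def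
  proof (intro conjI allI impI)
    show "cyclic_subgroup (generate G {y}) G"
      using y Hc by (auto simp: cyclic_subgroup_iff)
    fix K assume K: "cyclic_subgroup K G \<and> generate G {y} \<subseteq> K"
    then obtain z where z: "z \<in> carrier G" "K = generate G {z}"
      by (auto simp: cyclic_subgroup_iff)
    show "K = generate G {y}"
    proof (rule ccontr)
      assume "K \<noteq> generate G {y}"
      then have less: "generate G {y} \<subset> generate G {z}"
        using K z by blast
      obtain w where w: "w \<in> ?H" "generate G {w} \<noteq> generate G {y}"
        using other by blast
      \<comment> \<open>Members of a hat class have the same strict upper bounds, so a larger cyclic
        subgroup would contain two different involutions.\<close>
      have "generate G {w} \<subset> generate G {z}"
        using hat_class_below_iff(2)[OF y w(1) z(1)] less by blast
      then have "w \<in> generate G {z}" "y \<in> generate G {z}"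
        using less gen y w by blast+
      then have "y = w"
        using cyclic_involution_unique[OF z(1)] invol ne_one y w(1) by blast
      then show False
        using w by blast
    qed
  qed
  \<comment> \<open>Two distinct classes bound \<open>card\<close> from below only for a finite set,
    since \<open>card\<close> is 0 on infinite ones.\<close>
  have "finite (cyclic_class G ` ?H)"
    using fin Hc finite_subset by blast
  moreover have "{cyclic_class G x, cyclic_class G x'} \<subseteq> cyclic_class G ` ?H"
    using xH x' by blast
  moreover have "cyclic_class G x \<noteq> cyclic_class G x'"
    using x x' by (auto simp: cyclic_class_def)
  ultimately show r: "num_cyclic_classes G x \<ge> 2"
    unfolding num_cyclic_classes_def by (metis card_2_iff card_mono)
  have "ord x = 2"
    using card[OF xH] x by (simp add: generate_pow_card)
  then show "type_II G x 2 (num_cyclic_classes G x)"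
    using r max card by (simp add: type_II_def)
qed

end

theorem theorem6p2:
  fixes G :: "('a, 'b) monoid_scheme"
  assumes "group G" and "finite (carrier G)"
  shows "digraph_Aut (directed_power_graph G) \<subseteq> digraph_Aut (directed_reduced_power_graph G) \<and>
    (digraph_Aut (directed_reduced_power_graph G) \<subseteq> digraph_Aut (directed_power_graph G) \<longleftrightarrow>
      (\<forall>x \<in> carrier G. type_I G x \<or> (\<exists>r \<ge> 2. type_II G x 2 r)))"
proof (intro conjI iffI)
  interpret group G by fact
  \<comment> \<open>Strict inclusion is inclusion without the reverse inclusion, and both are
    preserved.\<close>
  show "digraph_Aut (directed_power_graph G) \<subseteq> digraph_Aut (directed_reduced_power_graph G)"
    by (simp add: subset_iff digraph_Aut_directed_power_graph
        digraph_Aut_directed_reduced_power_graph less_le_not_le)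
  show "\<forall>x \<in> carrier G. type_I G x \<or> (\<exists>r \<ge> 2. type_II G x 2 r)"
    if "digraph_Aut (directed_reduced_power_graph G) \<subseteq> digraph_Aut (directed_power_graph G)"
    using type_II_2_if_not_type_I[OF assms(2) _ that] by blast
  show "digraph_Aut (directed_reduced_power_graph G) \<subseteq> digraph_Aut (directed_power_graph G)"
    if hyp: "\<forall>x \<in> carrier G. type_I G x \<or> (\<exists>r \<ge> 2. type_II G x 2 r)"
  proof
    fix f assume f: "f \<in> digraph_Aut (directed_reduced_power_graph G)"
    then have p: "f permutes carrier G"
      and iff: "\<And>u v. \<lbrakk>u \<in> carrier G; v \<in> carrier G\<rbrakk> \<Longrightarrow>
        generate G {f v} \<subset> generate G {f u} \<longleftrightarrow> generate G {v} \<subset> generate G {u}"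
      by (simp_all add: digraph_Aut_directed_reduced_power_graph)
    have eq: "generate G {f v} = generate G {f u} \<longleftrightarrow> generate G {v} = generate G {u}"
      if "u \<in> carrier G" "v \<in> carrier G" for u v
    proof
      assume "generate G {f v} = generate G {f u}"
      \<comment> \<open>Reflecting equality under \<open>f\<close> is preserving it under the
        inverse automorphism.\<close>
      then have "generate G {inv_into UNIV f (f v)} =
          generate G {inv_into UNIV f (f u)}"
        using reduced_Aut_preserves_generate_eq[OF hyp digraph_Aut_inv[OF f]] that p
        by (simp add: permutes_in_image)
      then show "generate G {v} = generate G {u}"
        by (simp add: permutes_inverses[OF p])
    next
      assume "generate G {v} = generate G {u}"
      then show "generate G {f v} = generate G {f u}"
        using reduced_Aut_preserves_generate_eq[OF hyp f] that by blast
    qed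
    \<comment> \<open>Inclusion is strict inclusion or equality, and \<open>f\<close> preserves and
      reflects each.\<close>
    show "f \<in> digraph_Aut (directed_power_graph G)"
      using p iff eq by (simp add: digraph_Aut_directed_power_graph subset_iff_psubset_eq)
  qed
qed

end
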